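(* There is a propagation-complete CNF encoding of the constraint $\mathsf{AtMostOne}(x_1,\dots,x_n)$ using $2n + 2\sqrt{2n} + O(\sqrt[3]{n})$ clauses and $\sqrt{2n} + O(\sqrt[3]{n})$ auxiliary variables (asymptotics as $n \to \infty$).
   Context: $\mathsf{AtMostOne}(x_1,\dots,x_n)$ is the Boolean function that is true iff at most one of $x_1,\dots,x_n$ is true. A CNF formula is a set of clauses (each a set of literals); its size is its number of clauses. For a partial assignment $\tau$ and CNF $\varphi$, $\varphi|_\tau$ is obtained by deleting every clause satisfied by $\tau$ and deleting from the remaining clauses every literal falsified by $\tau$. A CNF $\varphi$ over variables $X \sqcup Y$, with $X=(x_1,\dots,x_n)$, encodes $f:\{\bot,\top\}^n\to\{\bot,\top\}$ if for every assignment $\tau$ of $X$, $f(\tau(x_1),\dots,\tau(x_n))=\top$ iff $\varphi|_\tau$ is satisfiable; variables of $Y$ are auxiliary. Such an encoding is propagation complete if for all literals $\ell_1,\dots,\ell_m$ over $X$: whenever $\varphi\wedge\bigwedge_{i<m}\ell_i \models \ell_m$, either $\ell_m$ or the empty clause can be derived from $\varphi\wedge\bigwedge_{i<m}\ell_i$ by unit propagation. *)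

theory Defs
  imports Complex_Main "HOL-Library.Landau_Symbols"
begin

datatype 'v literal = Pos 'v | Neg 'v

type_synonym 'v clause = "'v literal set"
type_synonym 'v cnf = "'v clause set"

primrec lit_var :: "'v literal \<Rightarrow> 'v" where
  "lit_var (Pos v) = v"
| "lit_var (Neg v) = v"

primrec lit_neg :: "'v literal \<Rightarrow> 'v literal" where
  "lit_neg (Pos v) = Neg v"
| "lit_neg (Neg v) = Pos v"

definition cnf_vars :: "'v cnf \<Rightarrow> 'v set" where
  "cnf_vars \<phi> = lit_var ` \<Union>\<phi>"

primrec lit_holds :: "('v \<Rightarrow> bool) \<Rightarrow> 'v literal \<Rightarrow> bool" where
  "lit_holds \<sigma> (Pos v) = \<sigma> v"
| "lit_holds \<sigma> (Neg v) = (\<not> \<sigma> v)"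

definition cnf_holds :: "('v \<Rightarrow> bool) \<Rightarrow> 'v cnf \<Rightarrow> bool" where
  "cnf_holds \<sigma> \<phi> \<longleftrightarrow> (\<forall>C\<in>\<phi>. \<exists>l\<in>C. lit_holds \<sigma> l)"

definition satisfiable :: "'v cnf \<Rightarrow> bool" where
  "satisfiable \<phi> \<longleftrightarrow> (\<exists>\<sigma>. cnf_holds \<sigma> \<phi>)"

definition entails_lit :: "'v cnf \<Rightarrow> 'v literal \<Rightarrow> bool" where
  "entails_lit \<phi> l \<longleftrightarrow> (\<forall>\<sigma>. cnf_holds \<sigma> \<phi> \<longrightarrow> lit_holds \<sigma> l)"

primrec lit_value :: "('v \<rightharpoonup> bool) \<Rightarrow> 'v literal \<Rightarrow> bool option" where
  "lit_value \<tau> (Pos v) = \<tau> v"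
| "lit_value \<tau> (Neg v) = map_option Not (\<tau> v)"

definition cnf_restrict :: "'v cnf \<Rightarrow> ('v \<rightharpoonup> bool) \<Rightarrow> 'v cnf" where
  "cnf_restrict \<phi> \<tau> =
     (\<lambda>C. {l \<in> C. lit_value \<tau> l \<noteq> Some False}) ` {C \<in> \<phi>. \<not> (\<exists>l\<in>C. lit_value \<tau> l = Some True)}"

text \<open>
  Clauses derivable by unit propagation. A literal \<open>l\<close> is derived when the unit clause \<open>{l}\<close> is,
  a conflict when \<open>{}\<close> is.
\<close>
inductive unit_prop :: "'v cnf \<Rightarrow> 'v clause \<Rightarrow> bool" for \<phi> :: "'v cnf" where
  clause: "C \<in> \<phi> \<Longrightarrow> unit_prop \<phi> C"
| propagate: "unit_prop \<phi> {l} \<Longrightarrow> unit_prop \<phi> C \<Longrightarrow> lit_neg l \<in> C \<Longrightarrow> unit_prop \<phi> (C - {lit_neg l})"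

text \<open>
  An \<open>n\<close>-ary Boolean function is a predicate on Boolean lists, of which only the values on lists of
  length \<open>n = length xs\<close> matter here.
\<close>
definition encodes :: "'v cnf \<Rightarrow> 'v list \<Rightarrow> 'v set \<Rightarrow> (bool list \<Rightarrow> bool) \<Rightarrow> bool" where
  "encodes \<phi> xs Y f \<longleftrightarrow>
     finite \<phi> \<and> distinct xs \<and> finite Y \<and> set xs \<inter> Y = {} \<and> cnf_vars \<phi> \<subseteq> set xs \<union> Y \<and>
     (\<forall>\<tau>. dom \<tau> = set xs \<longrightarrow>
        (f (map (\<lambda>x. the (\<tau> x)) xs) \<longleftrightarrow> satisfiable (cnf_restrict \<phi> \<tau>)))"

definition propagation_complete :: "'v cnf \<Rightarrow> 'v set \<Rightarrow> bool" where
  "propagation_complete \<phi> X \<longleftrightarrow>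
     (\<forall>ls l. lit_var ` set ls \<subseteq> X \<and> lit_var l \<in> X \<longrightarrow>
        (let \<psi> = \<phi> \<union> (\<lambda>k. {k}) ` set ls
         in entails_lit \<psi> l \<longrightarrow> unit_prop \<psi> {l} \<or> unit_prop \<psi> {}))"

definition at_most_one :: "bool list \<Rightarrow> bool" where
  "at_most_one bs \<longleftrightarrow> card {i. i < length bs \<and> bs ! i} \<le> 1"

datatype var = InVar nat | AuxVar nat

definition in_vars :: "nat \<Rightarrow> var list" where
  "in_vars n = map InVar [1..<Suc n]"

end

theory Submission
  imports Defs "HOL-Library.Nat_Bijection"
begin

text \<open>
  Regard the inputs as edges of a graph on about \<open>sqrt (2 * n)\<close> vertices: \<open>x\<close> implies the variables
  of both of its endpoints, at the cost of two clauses per input. Then \<open>AtMostOne\<close> of the inputs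
  amounts to \<open>AtMostTwo\<close> of the vertices. The vertices are the points of a \<open>d \<times> d \<times> d\<close> cube, where
  \<open>d\<close> is of order \<open>n powr (1/6)\<close>, and only vertices whose first coordinates (blocks) differ are
  joined. A vertex \<open>(c, a, b)\<close> implies two slot variables, \<open>(c, a)\<close> of the first kind and \<open>(c, b)\<close> of
  the second kind, at the cost of two clauses per vertex. There are only \<open>d\<^sup>2\<close> slots of each kind, so
  \<open>AtMostTwo\<close> on each kind may be encoded with linearly many clauses. Since the two endpoints of an
  edge lie in different blocks, no third vertex has both its slots among those of the endpoints.
  Forbidding edges inside a block costs only \<open>d\<^sup>2\<close> additional vertices.
\<close>

section \<open>Unit propagation\<close>

lemma unit_prop_sound:
  assumes "unit_prop \<phi> C" "cnf_holds \<sigma> \<phi>"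
  shows "\<exists>l\<in>C. lit_holds \<sigma> l"
  using assms(1)
proof induction
  case (clause C)
  then show ?case using assms(2) by (auto simp: cnf_holds_def)
next
  case (propagate l C)
  have "\<not> lit_holds \<sigma> (lit_neg l)" using propagate by (cases l) auto
  then show ?case using propagate by auto
qed

lemma unit_prop_conflict:
  assumes "unit_prop \<psi> {Pos v}" "unit_prop \<psi> {Neg v}"
  shows "unit_prop \<psi> {}"
  using unit_prop.propagate[OF assms] by simp

text \<open>Implications are kept as pairs of variables: injectivity of this map reduces counting
  clauses to counting pairs, and models can be checked on pairs as well.\<close>

definition imp_clause :: "'v \<times> 'v \<Rightarrow> 'v clause" where
  "imp_clause e = {Neg (fst e), Pos (snd e)}"

lemma inj_imp_clause: "inj imp_clause"
  by (auto simp: inj_on_def imp_clause_def doubleton_eq_iff prod_eq_iff)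

lemma unit_prop_imp_forward:
  assumes "imp_clause (a, b) \<in> \<psi>" "unit_prop \<psi> {Pos a}"
  shows "unit_prop \<psi> {Pos b}"
proof -
  have "imp_clause (a, b) - {lit_neg (Pos a)} = {Pos b}" by (auto simp: imp_clause_def)
  then show ?thesis
    using unit_prop.propagate[OF assms(2) unit_prop.clause[OF assms(1)]] by (simp add: imp_clause_def)
qed

lemma unit_prop_imp_backward:
  assumes "imp_clause (a, b) \<in> \<psi>" "unit_prop \<psi> {Neg b}"
  shows "unit_prop \<psi> {Neg a}"
proof -
  have "imp_clause (a, b) - {lit_neg (Neg b)} = {Neg a}" by (auto simp: imp_clause_def)
  then show ?thesis
    using unit_prop.propagate[OF assms(2) unit_prop.clause[OF assms(1)]] by (simp add: imp_clause_def)
qed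

text \<open>Clauses are sets, so distinctness ensures that resolving away \<open>a\<close> and
  \<open>b\<close> leaves exactly the literal of \<open>c\<close>.\<close>

lemma unit_prop_neg3:
  assumes "{Neg a, Neg b, Neg c} \<in> \<psi>" "unit_prop \<psi> {Pos a}" "unit_prop \<psi> {Pos b}"
    and "distinct [a, b, c]"
  shows "unit_prop \<psi> {Neg c}"
proof -
  have "unit_prop \<psi> ({Neg a, Neg b, Neg c} - {lit_neg (Pos a)})"
    by (rule unit_prop.propagate) (use assms in \<open>auto intro: unit_prop.clause\<close>)
  moreover have "{Neg a, Neg b, Neg c} - {lit_neg (Pos a)} = {Neg b, Neg c}" using assms(4) by auto
  ultimately have "unit_prop \<psi> {Neg b, Neg c}" by simp
  then have "unit_prop \<psi> ({Neg b, Neg c} - {lit_neg (Pos b)})"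
    by (intro unit_prop.propagate[OF assms(3)]) auto
  moreover have "{Neg b, Neg c} - {lit_neg (Pos b)} = {Neg c}" using assms(4) by auto
  ultimately show ?thesis by simp
qed

section \<open>A criterion for propagation-complete AtMostOne encodings\<close>

text \<open>Restriction removes only what \<open>\<tau>\<close> decides, so overwriting a model of
  the restricted formula by \<open>\<tau>\<close> gives a model of \<open>\<phi>\<close>.\<close>

lemma satisfiable_cnf_restrict_iff:
  "satisfiable (cnf_restrict \<phi> \<tau>) \<longleftrightarrow> (\<exists>\<sigma>. cnf_holds \<sigma> \<phi> \<and> (\<forall>x b. \<tau> x = Some b \<longrightarrow> \<sigma> x = b))"
proof
  assume "satisfiable (cnf_restrict \<phi> \<tau>)"
  then obtain \<sigma> where \<sigma>: "cnf_holds \<sigma> (cnf_restrict \<phi> \<tau>)" by (auto simp: satisfiable_def)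
  define \<rho> where "\<rho> x = (case \<tau> x of None \<Rightarrow> \<sigma> x | Some b \<Rightarrow> b)" for x
  have val: "lit_value \<tau> l = Some b \<Longrightarrow> lit_holds \<rho> l = b"
       "lit_value \<tau> l = None \<Longrightarrow> lit_holds \<rho> l = lit_holds \<sigma> l" for l b
    by (cases l; auto simp: \<rho>_def)+
  have "\<exists>l\<in>C. lit_holds \<rho> l" if "C \<in> \<phi>" for C
  proof (cases "\<exists>l\<in>C. lit_value \<tau> l = Some True")
    case True
    then show ?thesis using val(1) by blast
  next
    case False
    then have "{l \<in> C. lit_value \<tau> l \<noteq> Some False} \<in> cnf_restrict \<phi> \<tau>"
      using that by (auto simp: cnf_restrict_def)
    then obtain l where "l \<in> C" "lit_value \<tau> l \<noteq> Some False" "lit_holds \<sigma> l"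
      using \<sigma> by (auto simp: cnf_holds_def)
    moreover from this False have "lit_value \<tau> l = None" by (cases "lit_value \<tau> l") auto
    ultimately show ?thesis using val(2) by blast
  qed
  then show "\<exists>\<sigma>. cnf_holds \<sigma> \<phi> \<and> (\<forall>x b. \<tau> x = Some b \<longrightarrow> \<sigma> x = b)"
    by (intro exI[of _ \<rho>]) (auto simp: cnf_holds_def \<rho>_def)
next
  assume "\<exists>\<sigma>. cnf_holds \<sigma> \<phi> \<and> (\<forall>x b. \<tau> x = Some b \<longrightarrow> \<sigma> x = b)"
  then obtain \<sigma> where \<sigma>: "cnf_holds \<sigma> \<phi>" "\<And>x b. \<tau> x = Some b \<Longrightarrow> \<sigma> x = b" by blast
  have "lit_value \<tau> l \<noteq> Some False" if "lit_holds \<sigma> l" for l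
    using that \<sigma>(2) by (cases l) auto
  then have "cnf_holds \<sigma> (cnf_restrict \<phi> \<tau>)"
    using \<sigma>(1) by (fastforce simp: cnf_holds_def cnf_restrict_def)
  then show "satisfiable (cnf_restrict \<phi> \<tau>)" by (auto simp: satisfiable_def)
qed

lemma at_most_one_map_iff:
  assumes "distinct xs"
  shows "at_most_one (map f xs) \<longleftrightarrow> (\<forall>x\<in>set xs. \<forall>y\<in>set xs. f x \<longrightarrow> f y \<longrightarrow> x = y)"
proof -
  have "at_most_one (map f xs) \<longleftrightarrow> (\<forall>i<length xs. \<forall>j<length xs. f (xs ! i) \<longrightarrow> f (xs ! j) \<longrightarrow> i = j)"
    by (auto simp: at_most_one_def card_le_Suc0_iff_eq)
  also have "\<dots> \<longleftrightarrow> (\<forall>x\<in>set xs. \<forall>y\<in>set xs. f x \<longrightarrow> f y \<longrightarrow> x = y)"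
    using assms by (auto simp: all_set_conv_all_nth nth_eq_iff_index_eq)
  finally show ?thesis .
qed

text \<open>Soundness of unit propagation turns \<open>propagates\<close> into uniqueness of the
  true input. Stating it for supersets \<open>\<psi>\<close> makes it apply to \<open>\<phi>\<close>
  together with any assumed literals.\<close>

lemma at_most_one_encoding:
  assumes "finite \<phi>" "distinct xs" "finite Y" "set xs \<inter> Y = {}" "cnf_vars \<phi> \<subseteq> set xs \<union> Y"
    and models: "\<And>I. \<lbrakk>I \<subseteq> set xs; \<forall>x\<in>I. \<forall>y\<in>I. x = y\<rbrakk> \<Longrightarrow>
                   \<exists>\<sigma>. cnf_holds \<sigma> \<phi> \<and> (\<forall>x\<in>set xs. \<sigma> x \<longleftrightarrow> x \<in> I)"
    and propagates: "\<And>x y \<psi>. \<lbrakk>x \<in> set xs; y \<in> set xs; x \<noteq> y; \<phi> \<subseteq> \<psi>; unit_prop \<psi> {Pos x}\<rbrakk> \<Longrightarrow>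
                 unit_prop \<psi> {Neg y}"
  shows "encodes \<phi> xs Y at_most_one" and "propagation_complete \<phi> (set xs)"
proof -
  have uniq: "x = y" if "cnf_holds \<sigma> \<phi>" "x \<in> set xs" "y \<in> set xs" "\<sigma> x" "\<sigma> y" for \<sigma> x y
  proof (rule ccontr)
    assume "x \<noteq> y"
    then have "unit_prop (insert {Pos x} \<phi>) {Neg y}"
      using that by (intro propagates[of x y]) (auto intro: unit_prop.clause)
    moreover have "cnf_holds \<sigma> (insert {Pos x} \<phi>)" using that by (auto simp: cnf_holds_def)
    ultimately show False using unit_prop_sound that by fastforce
  qed
  have "at_most_one (map (\<lambda>x. the (\<tau> x)) xs) \<longleftrightarrow> satisfiable (cnf_restrict \<phi> \<tau>)"
    if dom: "dom \<tau> = set xs" for \<tau>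
  proof
    assume "at_most_one (map (\<lambda>x. the (\<tau> x)) xs)"
    then have "\<forall>x\<in>{x\<in>set xs. the (\<tau> x)}. \<forall>y\<in>{x\<in>set xs. the (\<tau> x)}. x = y"
      using at_most_one_map_iff[OF assms(2)] by auto
    then obtain \<sigma> where "cnf_holds \<sigma> \<phi>" "\<forall>x\<in>set xs. \<sigma> x \<longleftrightarrow> x \<in> {x\<in>set xs. the (\<tau> x)}"
      using models[of "{x\<in>set xs. the (\<tau> x)}"] by auto
    moreover from this have "\<sigma> x = b" if "\<tau> x = Some b" for x b
      using that dom by (metis (no_types, lifting) domI mem_Collect_eq option.sel)
    ultimately show "satisfiable (cnf_restrict \<phi> \<tau>)"
      unfolding satisfiable_cnf_restrict_iff by blast
  next
    assume "satisfiable (cnf_restrict \<phi> \<tau>)"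
    then obtain \<sigma> where \<sigma>: "cnf_holds \<sigma> \<phi>" "\<And>x b. \<tau> x = Some b \<Longrightarrow> \<sigma> x = b"
      unfolding satisfiable_cnf_restrict_iff by blast
    have "the (\<tau> x) = \<sigma> x" if "x \<in> set xs" for x
      using that dom \<sigma>(2)[of x] by (metis domD option.sel)
    then show "at_most_one (map (\<lambda>x. the (\<tau> x)) xs)"
      unfolding at_most_one_map_iff[OF assms(2)] using uniq[OF \<sigma>(1)] by auto
  qed
  then show "encodes \<phi> xs Y at_most_one"
    using assms(1-5) by (auto simp: encodes_def)

  have "unit_prop \<psi> {l} \<or> unit_prop \<psi> {}"
    if ls: "lit_var ` set ls \<subseteq> set xs" and l: "lit_var l \<in> set xs"
      and \<psi>: "\<psi> = \<phi> \<union> (\<lambda>k. {k}) ` set ls" and ent: "entails_lit \<psi> l" for ls l \<psi>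
  proof -
    have hyp: "unit_prop \<psi> {k}" if "k \<in> set ls" for k
      using that \<psi> by (auto intro: unit_prop.clause)
    define I where "I = {x. Pos x \<in> set ls}"
    have I: "I \<subseteq> set xs" using ls by (force simp: I_def)
    have neg: "unit_prop \<psi> {Neg y}" if "x \<in> I" "y \<in> set xs" "x \<noteq> y" for x y
      using that I \<psi> hyp by (intro propagates[of x y]) (auto simp: I_def)
    show ?thesis
    proof (rule ccontr)
      assume no: "\<not> ?thesis"
      have uI: "\<forall>x\<in>I. \<forall>y\<in>I. x = y"
      proof (intro ballI, rule ccontr)
        fix x y assume "x \<in> I" "y \<in> I" "x \<noteq> y"
        then have "unit_prop \<psi> {Neg y}" "unit_prop \<psi> {Pos y}"
          using neg I hyp by (auto simp: I_def)
        then show False using unit_prop_conflict[of \<psi> y] no by simp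
      qed
      have consistent: "Neg x \<notin> set ls" if "x \<in> I" for x
        using that hyp[of "Pos x"] hyp[of "Neg x"] unit_prop_conflict[of \<psi> x] no by (auto simp: I_def)
      \<comment> \<open>\<open>J\<close> may be any set of inputs compatible with the assumed
        literals; it is taken to be \<open>I\<close> first and \<open>{y}\<close> later.\<close>
      have model: "lit_holds \<sigma> l"
        if \<sigma>: "cnf_holds \<sigma> \<phi>" "\<forall>x\<in>set xs. \<sigma> x \<longleftrightarrow> x \<in> J"
          and J: "I \<subseteq> J" "\<forall>x\<in>J. Neg x \<notin> set ls" for \<sigma> J
      proof -
        have "lit_holds \<sigma> k" if k: "k \<in> set ls" for k
        proof -
          have "lit_var k \<in> set xs" using ls k by auto
          then have "\<sigma> (lit_var k) \<longleftrightarrow> lit_var k \<in> J" using \<sigma>(2) by blast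
          then show ?thesis using k J by (cases k) (auto simp: I_def)
        qed
        then have "cnf_holds \<sigma> \<psi>" using \<sigma>(1) \<psi> by (auto simp: cnf_holds_def)
        then show ?thesis using ent by (auto simp: entails_lit_def)
      qed
      obtain \<sigma> where \<sigma>: "cnf_holds \<sigma> \<phi>" "\<forall>x\<in>set xs. \<sigma> x \<longleftrightarrow> x \<in> I"
        using models[OF I uI] by blast
      have holds: "lit_holds \<sigma> l" using model[OF \<sigma>] consistent by blast
      show False
      proof (cases l)
        case (Pos x)
        then have "x \<in> I" using holds \<sigma>(2) l by auto
        then show False using hyp no Pos by (auto simp: I_def)
      next
        case (Neg y)
        then have y: "y \<in> set xs" "y \<notin> I" using holds \<sigma>(2) l by auto
        \<comment> \<open>An input assumed true would propagate \<open>Neg y\<close>, so there is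
          none. Making \<open>y\<close> alone true then respects all assumptions and refutes
          \<open>l\<close>.\<close>
        then have "I = {}" using neg[of _ y] no Neg by auto
        obtain \<rho> where "cnf_holds \<rho> \<phi>" "\<forall>x\<in>set xs. \<rho> x \<longleftrightarrow> x \<in> {y}"
          using models[of "{y}"] y by auto
        moreover have "Neg y \<notin> set ls" using no Neg hyp by blast
        ultimately have "lit_holds \<rho> l" using model[of \<rho> "{y}"] \<open>I = {}\<close> by auto
        then show False using \<open>\<forall>x\<in>set xs. \<rho> x \<longleftrightarrow> x \<in> {y}\<close> y Neg by auto
      qed
    qed
  qed
  then show "propagation_complete \<phi> (set xs)"
    unfolding propagation_complete_def Let_def by blast
qed

section \<open>Encoding AtMostTwo\<close>

text \<open>Pairing a family number \<open>t\<close> with an index \<open>j\<close> keeps the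
  families of auxiliary variables disjoint.\<close>

definition aux :: "nat \<Rightarrow> nat \<Rightarrow> var" where
  "aux t j = AuxVar (prod_encode (t, j))"

lemma aux_eq_iff [simp]: "aux t j = aux t' j' \<longleftrightarrow> t = t' \<and> j = j'"
  and aux_neq_InVar [simp]: "aux t j \<noteq> InVar i" "InVar i \<noteq> aux t j"
  by (auto simp: aux_def)

text \<open>
  The slots are \<open>aux t j\<close> for \<open>j < M\<close>. The intended meaning of \<open>aux (t + 1) j\<close> is that some slot
  below \<open>j\<close> is true, and that of \<open>aux (t + 2) j\<close> is that some slot at or above \<open>j\<close> is true.
\<close>
definition counter_imps :: "nat \<Rightarrow> nat \<Rightarrow> (var \<times> var) set" where
  "counter_imps t M =
     (\<lambda>j. (aux t j, aux (t + 1) (Suc j))) ` {..<M} \<union>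
     (\<lambda>j. (aux (t + 1) j, aux (t + 1) (Suc j))) ` {..<M} \<union>
     (\<lambda>j. (aux t j, aux (t + 2) j)) ` {..<M} \<union>
     (\<lambda>j. (aux (t + 2) (Suc j), aux (t + 2) j)) ` {..<M}"

text \<open>Three true slots are caught at the middle one: a true slot \<open>j\<close> must not
  have true slots on both sides. \<open>Suc j\<close> makes the upper side strict.\<close>

definition counter_neg :: "nat \<Rightarrow> nat \<Rightarrow> var clause" where
  "counter_neg t j = {Neg (aux t j), Neg (aux (t + 1) j), Neg (aux (t + 2) (Suc j))}"

lemma finite_counter_imps: "finite (counter_imps t M)"
  by (simp add: counter_imps_def)

lemma card_counter_imps_le: "card (counter_imps t M) \<le> 4 * M"
proof -
  have "card (f ` {..<M}) \<le> M" for f :: "nat \<Rightarrow> var \<times> var"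
    using card_image_le[of "{..<M}" f] by simp
  then have le: "card (f1 ` {..<M} \<union> f2 ` {..<M} \<union> f3 ` {..<M} \<union> f4 ` {..<M}) \<le> M + M + M + M"
    for f1 f2 f3 f4 :: "nat \<Rightarrow> var \<times> var"
    by (meson add_mono card_Un_le order_trans)
  show ?thesis
    unfolding counter_imps_def by (rule order.trans[OF le]) simp
qed

text \<open>Slots \<open>p\<close> and \<open>q\<close> make the "below" flags from
  \<open>Suc p\<close> on and the "above" flags up to \<open>q\<close> true. A slot strictly between
  is then refuted directly. At \<open>p\<close> the negative clause refutes the "below" flag, and
  this falsity travels down to every slot under \<open>p\<close>; above \<open>q\<close> the
  argument is symmetric.\<close>

lemma counter_propagation:
  assumes imps: "imp_clause ` counter_imps t M \<subseteq> \<psi>" and negs: "counter_neg t ` {..<M} \<subseteq> \<psi>"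
    and p: "unit_prop \<psi> {Pos (aux t p)}" and q: "unit_prop \<psi> {Pos (aux t q)}"
    and "p < q" "q < M" "j < M" "j \<noteq> p" "j \<noteq> q"
  shows "unit_prop \<psi> {Neg (aux t j)}"
proof -
  have imp: "imp_clause (aux t i, aux (t + 1) (Suc i)) \<in> \<psi>"
    "imp_clause (aux (t + 1) i, aux (t + 1) (Suc i)) \<in> \<psi>"
    "imp_clause (aux t i, aux (t + 2) i) \<in> \<psi>"
    "imp_clause (aux (t + 2) (Suc i), aux (t + 2) i) \<in> \<psi>" if "i < M" for i
    using that imps by (auto simp: counter_imps_def)
  have neg: "{Neg (aux t i), Neg (aux (t + 1) i), Neg (aux (t + 2) (Suc i))} \<in> \<psi>" if "i < M" for i
    using that negs by (auto simp: counter_neg_def)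
  have low: "unit_prop \<psi> {Pos (aux (t + 1) i)}" if "Suc p \<le> i" "i \<le> M" for i
    using that
  proof (induction i rule: dec_induct)
    case base
    show ?case using unit_prop_imp_forward[OF imp(1) p] assms by simp
  next
    case (step i)
    then show ?case using unit_prop_imp_forward[OF imp(2)[of i]] by simp
  qed
  have high: "unit_prop \<psi> {Pos (aux (t + 2) i)}" if "i \<le> q" for i
    using that
  proof (induction i rule: inc_induct)
    case base
    show ?case using unit_prop_imp_forward[OF imp(3) q] assms by simp
  next
    case (step i)
    then show ?case using unit_prop_imp_forward[OF imp(4)[of i]] assms by simp
  qed
  consider "j < p" | "p < j" "j < q" | "q < j" using assms by linarith
  then show ?thesis
  proof cases
    case 1
    have "unit_prop \<psi> {Neg (aux (t + 1) i)}" if "i \<le> p" for i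
      using that
    proof (induction i rule: inc_induct)
      case base
      have "{Neg (aux t p), Neg (aux (t + 2) (Suc p)), Neg (aux (t + 1) p)} \<in> \<psi>"
        using neg[of p] assms by (simp add: insert_commute)
      then show ?case using unit_prop_neg3[OF _ p high[of "Suc p"]] assms by simp
    next
      case (step i)
      then show ?case using unit_prop_imp_backward[OF imp(2)[of i]] assms by simp
    qed
    then show ?thesis using unit_prop_imp_backward[OF imp(1)[of j]] assms 1 by simp
  next
    case 2
    have "{Neg (aux (t + 1) j), Neg (aux (t + 2) (Suc j)), Neg (aux t j)} \<in> \<psi>"
      using neg[of j] assms by (simp add: insert_commute)
    then show ?thesis using unit_prop_neg3[OF _ low[of j] high[of "Suc j"]] assms 2 by simp
  next
    case 3
    have "unit_prop \<psi> {Neg (aux (t + 2) i)}" if "Suc q \<le> i" "i \<le> M" for i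
      using that
    proof (induction i rule: dec_induct)
      case base
      show ?case using unit_prop_neg3[OF neg q low[of q]] assms by simp
    next
      case (step i)
      then show ?case using unit_prop_imp_backward[OF imp(4)[of i]] by simp
    qed
    then show ?thesis using unit_prop_imp_backward[OF imp(3)[of j]] assms 3 by simp
  qed
qed

section \<open>The graph encoding\<close>

text \<open>Cantor's pairing lists pairs by increasing coordinate sum, so, apart from the offset,
  the first \<open>n\<close> edges reach only about \<open>sqrt (2 * n)\<close> vertices.\<close>

definition edge_fst :: "nat \<Rightarrow> nat" where
  "edge_fst i = fst (prod_decode i)"

text \<open>The offset \<open>d\<^sup>2\<close> separates the blocks of the two endpoints.\<close>
definition edge_snd :: "nat \<Rightarrow> nat \<Rightarrow> nat" where
  "edge_snd d i = fst (prod_decode i) + snd (prod_decode i) + d\<^sup>2"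

lemma edge_eq_iff:
  "edge_fst i = edge_fst j \<and> edge_snd d i = edge_snd d j \<longleftrightarrow> i = j"
proof
  assume "edge_fst i = edge_fst j \<and> edge_snd d i = edge_snd d j"
  then have "prod_decode i = prod_decode j"
    by (auto simp: edge_fst_def edge_snd_def prod_eq_iff)
  then show "i = j" by simp
qed auto

text \<open>The vertex \<open>(c, a, b)\<close> of the cube is the number \<open>c * d\<^sup>2 + a * d + b\<close>.\<close>
definition slot1 :: "nat \<Rightarrow> nat \<Rightarrow> nat" where
  "slot1 d v = v div d"

text \<open>This numbers the pair \<open>(c, b)\<close>, as \<open>slot1\<close> numbers
  \<open>(c, a)\<close>; the quotient of either slot by \<open>d\<close> is the block
  \<open>c\<close>.\<close>

definition slot2 :: "nat \<Rightarrow> nat \<Rightarrow> nat" where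
  "slot2 d v = v div d\<^sup>2 * d + v mod d"

lemma slot1_div: "slot1 d v div d = v div d\<^sup>2"
  by (simp add: slot1_def power2_eq_square div_mult2_eq)

lemma slot2_div: "d > 0 \<Longrightarrow> slot2 d v div d = v div d\<^sup>2"
  by (simp add: slot2_def)

lemma slots_inj:
  assumes "d > 0" "slot1 d v = slot1 d w" "slot2 d v = slot2 d w"
  shows "v = w"
proof -
  have "v mod d = w mod d" using arg_cong[OF assms(3), of "\<lambda>x. x mod d"] by (simp add: slot2_def)
  then show ?thesis using assms(2) unfolding slot1_def by (metis div_mult_mod_eq)
qed

lemma slots_less:
  assumes "v < d ^ 3"
  shows "slot1 d v < d\<^sup>2" "slot2 d v < d\<^sup>2"
proof -
  have d: "d > 0" using assms by (cases d) auto
  show "slot1 d v < d\<^sup>2"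
    using assms d by (simp add: slot1_def less_mult_imp_div_less power2_eq_square power3_eq_cube)
  have "v div d\<^sup>2 < d"
    using assms by (simp add: less_mult_imp_div_less power2_eq_square power3_eq_cube)
  then have "(v div d\<^sup>2 + 1) * d \<le> d * d" by (intro mult_right_mono) auto
  then show "slot2 d v < d\<^sup>2"
    using mod_less_divisor[OF d, of v] unfolding slot2_def power2_eq_square
    by (simp add: algebra_simps)
qed

lemma edge_blocks:
  assumes "d > 0"
  shows "edge_fst i div d\<^sup>2 < edge_snd d i div d\<^sup>2"
proof -
  have "edge_fst i div d\<^sup>2 < (edge_fst i + d\<^sup>2) div d\<^sup>2" using assms by simp
  also have "\<dots> \<le> edge_snd d i div d\<^sup>2"
    by (intro div_le_mono) (simp add: edge_fst_def edge_snd_def)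
  finally show ?thesis .
qed

text \<open>Supplies the two distinct, ordered true slots that \<open>counter_propagation\<close>
  requires, for both kinds.\<close>

lemma edge_slots_less:
  assumes "d > 0"
  shows "slot1 d (edge_fst i) < slot1 d (edge_snd d i)" "slot2 d (edge_fst i) < slot2 d (edge_snd d i)"
proof -
  have less: "x < y" if "x div d < y div d" for x y :: nat
    using that div_le_mono[of y x d] by (meson leD leI)
  show "slot1 d (edge_fst i) < slot1 d (edge_snd d i)" "slot2 d (edge_fst i) < slot2 d (edge_snd d i)"
    by (rule less; use edge_blocks[OF assms, of i] in \<open>simp add: slot1_div slot2_div[OF assms]\<close>)+
qed

text \<open>Both slots of \<open>w\<close> carry its block. The endpoints that match them therefore
  share a block, hence coincide, and agree with \<open>w\<close> in both slots.\<close>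

lemma vertex_in_edge:
  assumes "d > 0" "slot1 d w \<in> slot1 d ` {edge_fst i, edge_snd d i}"
    "slot2 d w \<in> slot2 d ` {edge_fst i, edge_snd d i}"
  shows "w \<in> {edge_fst i, edge_snd d i}"
proof -
  obtain u v where uv: "u \<in> {edge_fst i, edge_snd d i}" "v \<in> {edge_fst i, edge_snd d i}"
    and slots: "slot1 d w = slot1 d u" "slot2 d w = slot2 d v"
    using assms(2,3) by blast
  have "u div d\<^sup>2 = v div d\<^sup>2"
    using slots slot1_div slot2_div[OF assms(1)] by metis
  then have "u = v" using uv edge_blocks[OF assms(1), of i] by auto
  then show ?thesis using slots_inj[OF assms(1)] slots uv by metis
qed

lemma edge_fst_neq_snd: "d > 0 \<Longrightarrow> edge_fst i \<noteq> edge_snd d i"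
  using edge_blocks[of d i] by auto

section \<open>The formula, its variables and its size\<close>

text \<open>Vertices are \<open>aux 0 v\<close>; the slots of the two kinds are \<open>aux 1 j\<close> and \<open>aux 4 j\<close>.\<close>
definition main_imps :: "nat \<Rightarrow> nat \<Rightarrow> nat \<Rightarrow> (var \<times> var) set" where
  "main_imps n k d =
     (\<lambda>i. (InVar i, aux 0 (edge_fst i))) ` {1..n} \<union>
     (\<lambda>i. (InVar i, aux 0 (edge_snd d i))) ` {1..n} \<union>
     (\<lambda>v. (aux 0 v, aux 1 (slot1 d v))) ` {..<k} \<union>
     (\<lambda>v. (aux 0 v, aux 4 (slot2 d v))) ` {..<k}"

definition graph_cnf :: "nat \<Rightarrow> nat \<Rightarrow> nat \<Rightarrow> var cnf" where
  "graph_cnf n k d =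
     imp_clause ` (main_imps n k d \<union> (counter_imps 1 (d\<^sup>2) \<union> counter_imps 4 (d\<^sup>2))) \<union>
     (counter_neg 1 ` {..<d\<^sup>2} \<union> counter_neg 4 ` {..<d\<^sup>2})"

text \<open>Each counter occupies three families, 1 to 3 and 4 to 6. The index
  \<open>d\<^sup>2\<close> is included because flags occur at \<open>Suc j\<close> for
  \<open>j < d\<^sup>2\<close>.\<close>

definition graph_aux :: "nat \<Rightarrow> nat \<Rightarrow> var set" where
  "graph_aux k d = case_prod aux ` ({0} \<times> {..<k} \<union> {1..6} \<times> {..d\<^sup>2})"

lemma card_graph_aux: "card (graph_aux k d) = k + 6 * (d\<^sup>2 + 1)"
proof -
  have "card (graph_aux k d) = card ({0::nat} \<times> {..<k} \<union> {1..6::nat} \<times> {..d\<^sup>2})"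
    unfolding graph_aux_def by (rule card_image) (auto simp: inj_on_def)
  also have "\<dots> = k + 6 * (d\<^sup>2 + 1)"
    by (subst card_Un_disjoint) (auto simp: card_cartesian_product)
  finally show ?thesis .
qed

lemma card_main_imps:
  assumes "d > 0"
  shows "card (main_imps n k d) = 2 * n + 2 * k"
proof -
  have "inj_on (\<lambda>i. (InVar i, aux 0 (edge_fst i))) {1..n}"
    "inj_on (\<lambda>i. (InVar i, aux 0 (edge_snd d i))) {1..n}"
    "inj_on (\<lambda>v. (aux 0 v, aux 1 (slot1 d v))) {..<k}"
    "inj_on (\<lambda>v. (aux 0 v, aux 4 (slot2 d v))) {..<k}"
    by (auto simp: inj_on_def)
  note cards = this[THEN card_image]
  show ?thesis
    unfolding main_imps_def using edge_fst_neq_snd[OF assms]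
    by (subst card_Un_disjoint; (subst card_Un_disjoint)?; (subst card_Un_disjoint)?)
       (auto simp: cards simp del: One_nat_def)
qed

lemma finite_graph_cnf: "finite (graph_cnf n k d)"
  by (simp add: graph_cnf_def main_imps_def finite_counter_imps)

text \<open>The asymptotic claim bounds an absolute difference, hence the lower bound. The 10
  counts, per slot index, four implications and one negative clause in each of two counters.\<close>

lemma card_graph_cnf:
  assumes "d > 0"
  shows "2 * n + 2 * k \<le> card (graph_cnf n k d)"
    and "card (graph_cnf n k d) \<le> 2 * n + 2 * k + 10 * d\<^sup>2"
proof -
  have "card (imp_clause ` main_imps n k d) = 2 * n + 2 * k"
    by (simp add: card_image inj_on_subset[OF inj_imp_clause] card_main_imps[OF assms])
  moreover have "imp_clause ` main_imps n k d \<subseteq> graph_cnf n k d" by (auto simp: graph_cnf_def)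
  ultimately show "2 * n + 2 * k \<le> card (graph_cnf n k d)"
    using card_mono[OF finite_graph_cnf] by metis
  have neg: "card (counter_neg t ` {..<d\<^sup>2}) \<le> d\<^sup>2" for t
    using card_image_le[of "{..<d\<^sup>2}" "counter_neg t"] by simp
  let ?R = "main_imps n k d \<union> (counter_imps 1 (d\<^sup>2) \<union> counter_imps 4 (d\<^sup>2))"
  have "card (imp_clause ` ?R) \<le> card ?R"
    by (intro card_image_le) (simp add: main_imps_def finite_counter_imps)
  also have "\<dots> \<le> card (main_imps n k d) + (card (counter_imps 1 (d\<^sup>2)) + card (counter_imps 4 (d\<^sup>2)))"
    by (meson add_left_mono card_Un_le order_trans)
  finally have "card (imp_clause ` ?R) \<le> 2 * n + 2 * k + 8 * d\<^sup>2"
    using card_main_imps[OF assms, of n k] card_counter_imps_le[of 1 "d\<^sup>2"]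
      card_counter_imps_le[of 4 "d\<^sup>2"] by linarith
  moreover have "card (counter_neg 1 ` {..<d\<^sup>2} \<union> counter_neg 4 ` {..<d\<^sup>2}) \<le> 2 * d\<^sup>2"
    using card_Un_le[of "counter_neg 1 ` {..<d\<^sup>2}" "counter_neg 4 ` {..<d\<^sup>2}"] neg[of 1] neg[of 4]
    by linarith
  ultimately show "card (graph_cnf n k d) \<le> 2 * n + 2 * k + 10 * d\<^sup>2"
    using card_Un_le[of "imp_clause ` ?R" "counter_neg 1 ` {..<d\<^sup>2} \<union> counter_neg 4 ` {..<d\<^sup>2}"]
    unfolding graph_cnf_def by linarith
qed

lemma cnf_vars_graph_cnf:
  assumes "\<And>i. i \<in> {1..n} \<Longrightarrow> edge_snd d i < k" "k \<le> d ^ 3"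
  shows "cnf_vars (graph_cnf n k d) \<subseteq> InVar ` {1..n} \<union> graph_aux k d"
proof -
  have memI: "aux t j \<in> graph_aux k d" if "t = 0 \<and> j < k \<or> t \<in> {1..6} \<and> j \<le> d\<^sup>2" for t j
    using that by (force simp: graph_aux_def)
  have fst: "edge_fst i < k" if "i \<in> {1..n}" for i
    using assms(1)[OF that] by (simp add: edge_fst_def edge_snd_def)
  have slots: "slot1 d v \<le> d\<^sup>2" "slot2 d v \<le> d\<^sup>2" if "v < k" for v
    using slots_less[of v d] that assms(2) by auto
  have "fst e \<in> InVar ` {1..n} \<union> graph_aux k d \<and> snd e \<in> InVar ` {1..n} \<union> graph_aux k d"
    if "e \<in> main_imps n k d \<union> (counter_imps 1 (d\<^sup>2) \<union> counter_imps 4 (d\<^sup>2))" for e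
    using that assms(1) fst slots
    unfolding main_imps_def counter_imps_def by (auto intro!: memI)
  then show ?thesis
    unfolding cnf_vars_def graph_cnf_def imp_clause_def counter_neg_def
    by (fastforce intro!: memI)
qed

section \<open>Models of the graph encoding and its propagation\<close>

lemma graph_cnf_model:
  assumes "\<forall>x\<in>I. \<forall>y\<in>I. x = y"
  shows "\<exists>\<sigma>. cnf_holds \<sigma> (graph_cnf n k d) \<and> (\<forall>i. \<sigma> (InVar i) \<longleftrightarrow> i \<in> I)"
proof -
  define S where "S = (\<Union>i\<in>I. {edge_fst i, edge_snd d i})"
  define A where "A t = (if t = 1 then slot1 d else slot2 d) ` S" for t :: nat
  \<comment> \<open>The true vertices are the endpoints of the chosen edge, and the true slots are
    their images. Families 2 and 5 are the "below" flags, 3 and 6 the "above" flags; subtracting 1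
    or 2 leads back to the slot family.\<close>
  define val where "val t j =
    (if t = 0 then j \<in> S
     else if t = 1 \<or> t = 4 then j \<in> A t
     else if t = 2 \<or> t = 5 then \<exists>i\<in>A (t - 1). i < j
     else \<exists>i\<in>A (t - 2). j \<le> i)" for t j :: nat
  define \<sigma> where "\<sigma> x = (case x of InVar i \<Rightarrow> i \<in> I | AuxVar a \<Rightarrow> case_prod val (prod_decode a))" for x
  have \<sigma>_simps: "\<sigma> (InVar i) = (i \<in> I)" "\<sigma> (aux t j) = val t j" for i t j
    by (auto simp: \<sigma>_def aux_def)
  obtain u v where S: "S \<subseteq> {u, v}"
  proof (cases "I = {}")
    case True
    then show ?thesis using that by (auto simp: S_def)
  next
    case False
    then obtain i where "I = {i}" using assms by blast
    then show ?thesis using that[of "edge_fst i" "edge_snd d i"] by (auto simp: S_def)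
  qed
  \<comment> \<open>At most two vertices are true, hence at most two slots of each kind, so no
    negative counter clause is violated.\<close>
  have A: "\<exists>a b. A t \<subseteq> {a, b}" for t
    using S by (auto simp: A_def)
  have imp: "\<sigma> (fst e) \<longrightarrow> \<sigma> (snd e)"
    if "e \<in> main_imps n k d \<union> (counter_imps 1 (d\<^sup>2) \<union> counter_imps 4 (d\<^sup>2))" for e
  proof -
    have "\<sigma> (fst e) \<longrightarrow> \<sigma> (snd e)" if "e \<in> main_imps n k d"
      using that by (auto simp: main_imps_def \<sigma>_simps val_def S_def A_def)
    moreover have "\<sigma> (fst e) \<longrightarrow> \<sigma> (snd e)" if "e \<in> counter_imps t (d\<^sup>2)" "t = 1 \<or> t = 4" for t
      using that by (auto simp: counter_imps_def \<sigma>_simps val_def) (meson less_SucI Suc_leD)+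
    ultimately show ?thesis using that by blast
  qed
  have neg: "\<not> (\<sigma> (aux t j) \<and> \<sigma> (aux (t + 1) j) \<and> \<sigma> (aux (t + 2) (Suc j)))" if "t = 1 \<or> t = 4" for t j
  proof -
    have "\<not> (i < j \<and> j < h)" if "i \<in> A t" "j \<in> A t" "h \<in> A t" for i h
    proof -
      obtain a b where "A t \<subseteq> {a, b}" using A by blast
      then have "i \<in> {a, b}" "j \<in> {a, b}" "h \<in> {a, b}" using that by blast+
      then show ?thesis by auto
    qed
    then show ?thesis using that unfolding \<sigma>_simps val_def by (auto simp: Suc_le_eq)
  qed
  have "\<exists>l\<in>imp_clause e. lit_holds \<sigma> l" if "\<sigma> (fst e) \<longrightarrow> \<sigma> (snd e)" for e
    using that by (auto simp: imp_clause_def)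
  moreover have "\<exists>l\<in>counter_neg t j. lit_holds \<sigma> l" if "t = 1 \<or> t = 4" for t j
    using neg[OF that, of j] by (auto simp: counter_neg_def)
  ultimately have "cnf_holds \<sigma> (graph_cnf n k d)"
    using imp unfolding cnf_holds_def graph_cnf_def by blast
  then show ?thesis using \<sigma>_simps by blast
qed

text \<open>Truth flows from input \<open>i\<close> to its endpoints and their slots. The counters
  then refute all other slots, thereby every vertex off edge \<open>i\<close>, and finally any input
  with such an endpoint.\<close>

lemma graph_cnf_propagation:
  assumes "\<And>i. i \<in> {1..n} \<Longrightarrow> edge_snd d i < k" "k \<le> d ^ 3" "d > 0"
    and \<psi>: "graph_cnf n k d \<subseteq> \<psi>" and up: "unit_prop \<psi> {Pos (InVar i)}"
    and i: "i \<in> {1..n}" and j: "j \<in> {1..n}" and "i \<noteq> j"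
  shows "unit_prop \<psi> {Neg (InVar j)}"
proof -
  have main: "imp_clause e \<in> \<psi>" if "e \<in> main_imps n k d" for e
    using \<psi> that by (auto simp: graph_cnf_def)
  have edge: "imp_clause (InVar h, aux 0 w) \<in> \<psi>" if "h \<in> {1..n}" "w \<in> {edge_fst h, edge_snd d h}" for h w
    using that by (auto intro!: main simp: main_imps_def)
  have slot: "imp_clause (aux 0 w, aux 1 (slot1 d w)) \<in> \<psi>" "imp_clause (aux 0 w, aux 4 (slot2 d w)) \<in> \<psi>"
    if "w < k" for w
    using that by (auto intro!: main simp: main_imps_def)
  have less: "w < k" if "h \<in> {1..n}" "w \<in> {edge_fst h, edge_snd d h}" for h w
    using assms(1)[OF that(1)] that(2) by (auto simp: edge_fst_def edge_snd_def)
  have slot_less: "slot1 d w < d\<^sup>2" "slot2 d w < d\<^sup>2" if "w < k" for w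
    using slots_less[of w d] that assms(2) by auto
  have vert: "unit_prop \<psi> {Pos (aux 0 w)}" if "w \<in> {edge_fst i, edge_snd d i}" for w
    using unit_prop_imp_forward[OF edge[OF i that] up] .
  have pos: "unit_prop \<psi> {Pos (aux 1 (slot1 d w))}" "unit_prop \<psi> {Pos (aux 4 (slot2 d w))}"
    if "w \<in> {edge_fst i, edge_snd d i}" for w
    using slot[OF less[OF i that], THEN unit_prop_imp_forward] vert[OF that] by auto
  have counter: "imp_clause ` counter_imps t (d\<^sup>2) \<subseteq> \<psi>" "counter_neg t ` {..<d\<^sup>2} \<subseteq> \<psi>"
    if "t = 1 \<or> t = 4" for t
    using that \<psi> by (auto simp: graph_cnf_def)
  have neg: "unit_prop \<psi> {Neg (aux 0 w)}" if w: "w < k" and outside: "w \<notin> {edge_fst i, edge_snd d i}" for w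
  proof -
    consider "slot1 d w \<notin> slot1 d ` {edge_fst i, edge_snd d i}"
      | "slot2 d w \<notin> slot2 d ` {edge_fst i, edge_snd d i}"
      using vertex_in_edge[OF \<open>d > 0\<close>, of w i] outside by metis
    then show ?thesis
    proof cases
      case 1
      have "unit_prop \<psi> {Neg (aux 1 (slot1 d w))}"
        by (rule counter_propagation[OF counter pos(1)[of "edge_fst i"] pos(1)[of "edge_snd d i"]])
          (use 1 edge_slots_less[OF \<open>d > 0\<close>] slot_less w less[OF i] in auto)
      then show ?thesis by (rule unit_prop_imp_backward[OF slot(1)[OF w]])
    next
      case 2
      have "unit_prop \<psi> {Neg (aux 4 (slot2 d w))}"
        by (rule counter_propagation[OF counter pos(2)[of "edge_fst i"] pos(2)[of "edge_snd d i"]])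
          (use 2 edge_slots_less[OF \<open>d > 0\<close>] slot_less w less[OF i] in auto)
      then show ?thesis by (rule unit_prop_imp_backward[OF slot(2)[OF w]])
    qed
  qed
  \<comment> \<open>Endpoints are ordered, so containment of the endpoint sets of two edges would
    force the edges to be equal.\<close>
  obtain w where w: "w \<in> {edge_fst j, edge_snd d j}" "w \<notin> {edge_fst i, edge_snd d i}"
  proof -
    have "edge_fst h < edge_snd d h" for h
      using \<open>d > 0\<close> by (simp add: edge_fst_def edge_snd_def)
    then have "{edge_fst j, edge_snd d j} \<subseteq> {edge_fst i, edge_snd d i} \<Longrightarrow> i = j"
      using edge_eq_iff[of i j d] by (metis insert_subset insertE singletonD less_asym less_irrefl)
    then show ?thesis using that \<open>i \<noteq> j\<close> by blast
  qed
  show ?thesis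
    using unit_prop_imp_backward[OF edge[OF j w(1)] neg[OF less[OF j w(1)] w(2)]] .
qed

lemma graph_cnf_encoding:
  assumes "\<And>i. i \<in> {1..n} \<Longrightarrow> edge_snd d i < k" "k \<le> d ^ 3" "d > 0"
  shows "encodes (graph_cnf n k d) (in_vars n) (graph_aux k d) at_most_one"
    and "propagation_complete (graph_cnf n k d) (set (in_vars n))"
proof -
  have set: "set (in_vars n) = InVar ` {1..n}"
    by (auto simp: in_vars_def atLeastLessThanSuc_atLeastAtMost)
  have "distinct (in_vars n)" by (auto simp: in_vars_def distinct_map inj_on_def)
  moreover have "finite (graph_aux k d)" by (simp add: graph_aux_def)
  moreover have "set (in_vars n) \<inter> graph_aux k d = {}" by (auto simp: set graph_aux_def)
  moreover have "cnf_vars (graph_cnf n k d) \<subseteq> set (in_vars n) \<union> graph_aux k d"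
    using cnf_vars_graph_cnf assms set by simp
  moreover have "\<exists>\<sigma>. cnf_holds \<sigma> (graph_cnf n k d) \<and> (\<forall>x\<in>set (in_vars n). \<sigma> x \<longleftrightarrow> x \<in> I)"
    if "\<forall>x\<in>I. \<forall>y\<in>I. x = y" for I
  proof -
    have "\<forall>i\<in>{i. InVar i \<in> I}. \<forall>j\<in>{i. InVar i \<in> I}. i = j" using that by blast
    from graph_cnf_model[OF this, of n k d] show ?thesis by (auto simp: set)
  qed
  moreover have "unit_prop \<psi> {Neg y}"
    if "x \<in> set (in_vars n)" "y \<in> set (in_vars n)" "x \<noteq> y" "graph_cnf n k d \<subseteq> \<psi>"
      "unit_prop \<psi> {Pos x}" for x y \<psi>
    using that graph_cnf_propagation[OF assms that(4)] unfolding set by blast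
  ultimately show "encodes (graph_cnf n k d) (in_vars n) (graph_aux k d) at_most_one"
    and "propagation_complete (graph_cnf n k d) (set (in_vars n))"
    using at_most_one_encoding[OF finite_graph_cnf, of "in_vars n" "graph_aux k d" n k d] by simp_all
qed

section \<open>Choice of the parameters\<close>

text \<open>The factor 2 leaves room in the cube for the additional \<open>d\<^sup>2\<close>
  vertices caused by the offset; the summand 1 keeps the side positive at
  \<open>n = 0\<close>.\<close>

definition side :: "nat \<Rightarrow> nat" where
  "side n = 2 * (nat \<lceil>root 6 (real n)\<rceil> + 1)"

definition vertices :: "nat \<Rightarrow> nat" where
  "vertices n = nat \<lfloor>sqrt (2 * real n)\<rfloor> + 1 + (side n)\<^sup>2"

lemma side_pos: "side n > 0"
  by (simp add: side_def)

text \<open>The Cantor code of \<open>(a, b)\<close> is at least the triangular number of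
  \<open>a + b\<close>, which gives \<open>(a + b)\<^sup>2 \<le> 2 * n\<close>.\<close>

lemma edge_snd_less_vertices:
  assumes "i \<le> n"
  shows "edge_snd (side n) i < vertices n"
proof -
  define a b where "a = fst (prod_decode i)" and "b = snd (prod_decode i)"
  have "triangle (a + b) \<le> prod_encode (a, b)" by (simp add: prod_encode_def)
  also have "prod_encode (a, b) = i" by (simp add: a_def b_def)
  finally have "triangle (a + b) \<le> n" using assms by simp
  moreover have "2 * triangle (a + b) = (a + b) * Suc (a + b)"
    unfolding triangle_def by (rule even_two_times_div_two) simp
  ultimately have "(a + b) * Suc (a + b) \<le> 2 * n" by linarith
  then have "(a + b)\<^sup>2 \<le> 2 * n" by (simp add: power2_eq_square)
  then have "real (a + b) ^ 2 \<le> 2 * real n"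
    by (metis of_nat_le_iff of_nat_mult of_nat_numeral of_nat_power)
  then have "real (a + b) \<le> sqrt (2 * real n)" by (rule real_le_rsqrt)
  then have "a + b \<le> nat \<lfloor>sqrt (2 * real n)\<rfloor>" by (simp add: le_nat_floor)
  then show ?thesis by (simp add: edge_snd_def vertices_def a_def b_def)
qed

lemma vertices_le_side_cube: "vertices n \<le> side n ^ 3"
proof -
  define r where "r = nat \<lceil>root 6 (real n)\<rceil>"
  have "root 6 (real n) \<le> real r" by (simp add: r_def)
  then have "root 6 (real n) ^ 6 \<le> real r ^ 6" by (intro power_mono) auto
  then have "real n \<le> (real r ^ 3)\<^sup>2" by (simp flip: power_mult)
  moreover have "(2 * real r ^ 3)\<^sup>2 = 4 * (real r ^ 3)\<^sup>2" by (simp add: power_mult_distrib)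
  ultimately have "2 * real n \<le> (2 * real r ^ 3)\<^sup>2" by linarith
  then have "sqrt (2 * real n) \<le> 2 * real r ^ 3" by (simp add: real_le_lsqrt)
  then have "sqrt (2 * real n) \<le> real (2 * r ^ 3)" by simp
  then have "nat \<lfloor>sqrt (2 * real n)\<rfloor> \<le> 2 * r ^ 3" by linarith
  moreover have "2 * r ^ 3 + 1 + (2 * (r + 1))\<^sup>2 \<le> (2 * (r + 1)) ^ 3"
    by (simp add: power2_eq_square power3_eq_cube algebra_simps)
  ultimately show ?thesis unfolding vertices_def side_def r_def[symmetric] by linarith
qed

text \<open>For \<open>s \<ge> 1\<close> rounding up costs at most a constant factor, so the side is
  at most \<open>6 * s\<close>. Its square gives 36 times the cube root, and the summand 1 is
  absorbed by one more.\<close>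

lemma side_square_le:
  assumes "n \<ge> 1"
  shows "1 + real ((side n)\<^sup>2) \<le> 37 * root 3 (real n)"
proof -
  define s where "s = root 6 (real n)"
  have "1 \<le> s" using assms by (simp add: s_def)
  define c where "c = nat \<lceil>s\<rceil>"
  have "real c + 1 \<le> 3 * s" using \<open>1 \<le> s\<close> unfolding c_def by linarith
  moreover have "side n = 2 * (c + 1)" by (simp add: side_def s_def c_def)
  ultimately have "real (side n) \<le> 6 * s" by simp
  then have "real (side n) ^ 2 \<le> (6 * s) ^ 2" by (intro power_mono) auto
  also have "s = sqrt (root 3 (real n))"
    using real_root_mult_exp[of 2 3 "real n"] by (simp add: s_def sqrt_def)
  finally have "real ((side n)\<^sup>2) \<le> 36 * root 3 (real n)" by (simp add: power_mult_distrib)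
  moreover have "1 \<le> root 3 (real n)" using assms by simp
  ultimately have "1 + real ((side n)\<^sup>2) \<le> root 3 (real n) + 36 * root 3 (real n)" by (rule add_mono[rotated])
  then show ?thesis by simp
qed

theorem theorem1:
  "\<exists>(\<phi> :: nat \<Rightarrow> var cnf) (Y :: nat \<Rightarrow> var set).
     (\<forall>n. encodes (\<phi> n) (in_vars n) (Y n) at_most_one \<and>
          propagation_complete (\<phi> n) (set (in_vars n))) \<and>
     (\<lambda>n. real (card (\<phi> n)) - (2 * real n + 2 * sqrt (2 * real n))) \<in> O(\<lambda>n. root 3 (real n)) \<and>
     (\<lambda>n. real (card (Y n)) - sqrt (2 * real n)) \<in> O(\<lambda>n. root 3 (real n))"
proof (intro exI conjI allI)
  let ?\<phi> = "\<lambda>n. graph_cnf n (vertices n) (side n)"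
  let ?Y = "\<lambda>n. graph_aux (vertices n) (side n)"
  have vertices_bounds: "sqrt (2 * real n) \<le> real (vertices n)"
    "real (vertices n) \<le> sqrt (2 * real n) + 1 + real ((side n)\<^sup>2)" for n
  proof -
    have "0 \<le> sqrt (2 * real n)" by simp
    then show "sqrt (2 * real n) \<le> real (vertices n)"
      "real (vertices n) \<le> sqrt (2 * real n) + 1 + real ((side n)\<^sup>2)"
      unfolding vertices_def by linarith+
  qed
  show "encodes (?\<phi> n) (in_vars n) (?Y n) at_most_one" "propagation_complete (?\<phi> n) (set (in_vars n))" for n
    using graph_cnf_encoding[OF _ vertices_le_side_cube side_pos] edge_snd_less_vertices by auto
  show "(\<lambda>n. real (card (?\<phi> n)) - (2 * real n + 2 * sqrt (2 * real n))) \<in> O(\<lambda>n. root 3 (real n))"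
  \<comment> \<open>The constant is generous: the estimates give 12 * 37 here and 7 * 37 for the
    auxiliary variables. Starting at 1 excludes \<open>n = 0\<close>, where the cube root
    vanishes.\<close>
  proof (rule bigoI[where c = 1000], rule eventually_sequentiallyI[of 1])
    fix n :: nat assume "n \<ge> 1"
    have "2 * real n + 2 * real (vertices n) \<le> real (card (?\<phi> n))"
      "real (card (?\<phi> n)) \<le> 2 * real n + 2 * real (vertices n) + 10 * real ((side n)\<^sup>2)"
      using card_graph_cnf[OF side_pos, of n "vertices n" n] by linarith+
    then have "\<bar>real (card (?\<phi> n)) - (2 * real n + 2 * sqrt (2 * real n))\<bar> \<le> 1000 * root 3 (real n)"
      using vertices_bounds[of n] side_square_le[OF \<open>n \<ge> 1\<close>] by linarith
    then show "norm (real (card (?\<phi> n)) - (2 * real n + 2 * sqrt (2 * real n))) \<le> 1000 * norm (root 3 (real n))"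
      by simp
  qed
  show "(\<lambda>n. real (card (?Y n)) - sqrt (2 * real n)) \<in> O(\<lambda>n. root 3 (real n))"
  proof (rule bigoI[where c = 1000], rule eventually_sequentiallyI[of 1])
    fix n :: nat assume "n \<ge> 1"
    have "real (card (?Y n)) = real (vertices n) + 6 * real ((side n)\<^sup>2) + 6"
      by (simp add: card_graph_aux)
    moreover have "0 \<le> real ((side n)\<^sup>2)" by (rule of_nat_0_le_iff)
    ultimately have "\<bar>real (card (?Y n)) - sqrt (2 * real n)\<bar> \<le> 1000 * root 3 (real n)"
      using vertices_bounds[of n] side_square_le[OF \<open>n \<ge> 1\<close>] by linarith
    then show "norm (real (card (?Y n)) - sqrt (2 * real n)) \<le> 1000 * norm (root 3 (real n))"
      by simp
  qed
qed

end
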